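(* Let $\mathcal{S}$ be a triangulated category containing all set-indexed coproducts. If the ideals $\mathcal{I}$ and $\mathcal{J}$ are parts of (stable) projective classes $(\mathcal{P},\mathcal{I})$ and $(\mathcal{Q},\mathcal{J})$ in $\mathcal{S}$, then so is their product $\mathcal{I}\mathcal{J}$, which consists of all composites $fg$ with $f$ in $\mathcal{I}$ and $g$ in $\mathcal{J}$ (first $g$, then $f$). The projectives of the corresponding projective class are precisely those objects which are retracts of objects $X$ which lie in cofibre sequences $Q\to X\to P$ with $Q$ in $\mathcal{Q}$ and $P$ in $\mathcal{P}$.
   Context: Cofibre sequence means exact triangle: $A\to B\to C$ is a cofibre sequence if it extends to an exact triangle $A\to B\to C\to\Sigma A$. For a class $\mathcal{P}$ of objects, $\mathcal{P}\text{-null}$ is the class of all maps $X\to Y$ such that the composite $P\to X\to Y$ is zero for all $P$ in $\mathcal{P}$ and all maps $P\to X$. For a class $\mathcal{I}$ of maps, $\mathcal{I}\text{-proj}$ is the class of all objects $P$ such that the composite $P\to X\to Y$ is zero for all maps $X\to Y$ in $\mathcal{I}$ and all maps $P\to X$. A projective class is a pair $(\mathcal{P},\mathcal{I})$, with $\mathcal{P}$ a class of objects and $\mathcal{I}$ a class of maps, such that $\mathcal{P}\text{-null}=\mathcal{I}$, $\mathcal{I}\text{-proj}=\mathcal{P}$, and each object $X$ lies in a cofibre sequence $P\to X\to Y$ with $P$ in $\mathcal{P}$ and $X\to Y$ in $\mathcal{I}$. Objects of $\mathcal{P}$ are called projectives; $\mathcal{I}$ is automatically a two-sided ideal. A projective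 class is stable if $\mathcal{P}$ and $\mathcal{I}$ are closed under suspension and desuspension. *)

theory Defs
  imports "HOL-Algebra.Group"
begin

text \<open>
  The data of a triangulated category: objects and arrows are carved out of ambient types by
  \<open>Obj\<close> and \<open>Arr\<close>; \<open>g \<cdot> f\<close> means first \<open>f\<close>, then \<open>g\<close>, and is meaningful only if \<open>Cod f = Dom g\<close>;
  \<open>Add\<close> is meaningful only for parallel arrows; \<open>SuspO\<close>, \<open>SuspA\<close> is the suspension functor and
  \<open>DesO\<close>, \<open>DesA\<close> the desuspension functor, on objects and arrows; \<open>Tri\<close> is the class of exact
  triangles, a triangle \<open>X \<rightarrow> Y \<rightarrow> Z \<rightarrow> \<Sigma>X\<close> being given by its three arrows.
\<close>

record ('o, 'a) tricat =
  Obj :: "'o set"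
  Arr :: "'a set"
  Dom :: "'a \<Rightarrow> 'o"
  Cod :: "'a \<Rightarrow> 'o"
  Comp :: "'a \<Rightarrow> 'a \<Rightarrow> 'a" (infixl "\<cdot>\<index>" 70)
  Ident :: "'o \<Rightarrow> 'a"
  Add :: "'a \<Rightarrow> 'a \<Rightarrow> 'a"
  Zero :: "'o \<Rightarrow> 'o \<Rightarrow> 'a"
  SuspO :: "'o \<Rightarrow> 'o"
  SuspA :: "'a \<Rightarrow> 'a"
  DesO :: "'o \<Rightarrow> 'o"
  DesA :: "'a \<Rightarrow> 'a"
  Tri :: "('a \<times> 'a \<times> 'a) set"

definition Hom :: "('o, 'a, 'm) tricat_scheme \<Rightarrow> 'o \<Rightarrow> 'o \<Rightarrow> 'a set" where
  "Hom C X Y = {f \<in> Arr C. Dom C f = X \<and> Cod C f = Y}"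

definition hom_group :: "('o, 'a, 'm) tricat_scheme \<Rightarrow> 'o \<Rightarrow> 'o \<Rightarrow> 'a monoid" where
  "hom_group C X Y = \<lparr>carrier = Hom C X Y, mult = Add C, one = Zero C X Y\<rparr>"

definition Neg :: "('o, 'a, 'm) tricat_scheme \<Rightarrow> 'a \<Rightarrow> 'a" where
  "Neg C f = inv\<^bsub>hom_group C (Dom C f) (Cod C f)\<^esub> f"

definition is_iso :: "('o, 'a, 'm) tricat_scheme \<Rightarrow> 'a \<Rightarrow> bool" where
  "is_iso C f \<longleftrightarrow> f \<in> Arr C \<and>
     (\<exists>g \<in> Hom C (Cod C f) (Dom C f).
        g \<cdot>\<^bsub>C\<^esub> f = Ident C (Dom C f) \<and> f \<cdot>\<^bsub>C\<^esub> g = Ident C (Cod C f))"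

definition retract_of :: "('o, 'a, 'm) tricat_scheme \<Rightarrow> 'o \<Rightarrow> 'o \<Rightarrow> bool" where
  "retract_of C Y X \<longleftrightarrow> (\<exists>s \<in> Hom C Y X. \<exists>r \<in> Hom C X Y. r \<cdot>\<^bsub>C\<^esub> s = Ident C Y)"

definition zero_object :: "('o, 'a, 'm) tricat_scheme \<Rightarrow> 'o \<Rightarrow> bool" where
  "zero_object C Z \<longleftrightarrow> Z \<in> Obj C \<and>
     (\<forall>X \<in> Obj C. (\<exists>!f. f \<in> Hom C X Z) \<and> (\<exists>!f. f \<in> Hom C Z X))"

definition biproduct ::
  "('o, 'a, 'm) tricat_scheme \<Rightarrow> 'o \<Rightarrow> 'o \<Rightarrow> 'o \<Rightarrow> 'a \<Rightarrow> 'a \<Rightarrow> 'a \<Rightarrow> 'a \<Rightarrow> bool" where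
  "biproduct C X Y B i j p q \<longleftrightarrow>
     B \<in> Obj C \<and> i \<in> Hom C X B \<and> j \<in> Hom C Y B \<and> p \<in> Hom C B X \<and> q \<in> Hom C B Y \<and>
     p \<cdot>\<^bsub>C\<^esub> i = Ident C X \<and> q \<cdot>\<^bsub>C\<^esub> j = Ident C Y \<and>
     p \<cdot>\<^bsub>C\<^esub> j = Zero C Y X \<and> q \<cdot>\<^bsub>C\<^esub> i = Zero C X Y \<and>
     Add C (i \<cdot>\<^bsub>C\<^esub> p) (j \<cdot>\<^bsub>C\<^esub> q) = Ident C B"

definition is_coproduct ::
  "('o, 'a, 'm) tricat_scheme \<Rightarrow> 'i set \<Rightarrow> ('i \<Rightarrow> 'o) \<Rightarrow> 'o \<Rightarrow> ('i \<Rightarrow> 'a) \<Rightarrow> bool" where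
  "is_coproduct C I X B \<iota> \<longleftrightarrow>
     B \<in> Obj C \<and> (\<forall>i \<in> I. \<iota> i \<in> Hom C (X i) B) \<and>
     (\<forall>Y \<in> Obj C. \<forall>f. (\<forall>i \<in> I. f i \<in> Hom C (X i) Y) \<longrightarrow>
        (\<exists>!h. h \<in> Hom C B Y \<and> (\<forall>i \<in> I. h \<cdot>\<^bsub>C\<^esub> \<iota> i = f i)))"

text \<open>
  A class of objects and the class of its arrows are \<open>HOL\<close> sets here, so ``set-indexed'' has to mean
  indexed by a small set: a category having coproducts indexed by arbitrary \<open>HOL\<close> sets is a
  preorder. The predicate below singles out the index sets that count as sets. Its closure properties
  hold for the small sets of any set-theoretic universe; closure under power sets is not
  demanded, so that such a predicate exists already in plain \<open>HOL\<close> (countable subsets of an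
  infinite type).
\<close>

locale small_sets =
  fixes small :: "'i set \<Rightarrow> bool"
  assumes small_subset: "small A \<Longrightarrow> B \<subseteq> A \<Longrightarrow> small B"
    and small_image: "small A \<Longrightarrow> small (f ` A)"
    and small_UN: "small A \<Longrightarrow> (\<And>a. a \<in> A \<Longrightarrow> small (F a)) \<Longrightarrow> small (\<Union>a\<in>A. F a)"
    and small_infinite: "\<exists>A. small A \<and> infinite A"

definition has_small_coproducts ::
  "('i set \<Rightarrow> bool) \<Rightarrow> ('o, 'a, 'm) tricat_scheme \<Rightarrow> bool" where
  "has_small_coproducts small C \<longleftrightarrow>
     (\<forall>I X. small I \<longrightarrow> (\<forall>i \<in> I. X i \<in> Obj C) \<longrightarrow> (\<exists>B \<iota>. is_coproduct C I X B \<iota>))"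

locale tri_category =
  fixes C :: "('o, 'a, 'm) tricat_scheme" (structure)
  assumes Dom_Obj: "f \<in> Arr C \<Longrightarrow> Dom C f \<in> Obj C"
    and Cod_Obj: "f \<in> Arr C \<Longrightarrow> Cod C f \<in> Obj C"
    and Ident_Hom: "X \<in> Obj C \<Longrightarrow> Ident C X \<in> Hom C X X"
    and Comp_Hom: "f \<in> Hom C X Y \<Longrightarrow> g \<in> Hom C Y Z \<Longrightarrow> g \<cdot> f \<in> Hom C X Z"
    and Comp_Ident_right: "f \<in> Hom C X Y \<Longrightarrow> f \<cdot> Ident C X = f"
    and Comp_Ident_left: "f \<in> Hom C X Y \<Longrightarrow> Ident C Y \<cdot> f = f"
    and Comp_assoc: "f \<in> Hom C W X \<Longrightarrow> g \<in> Hom C X Y \<Longrightarrow> h \<in> Hom C Y Z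
      \<Longrightarrow> (h \<cdot> g) \<cdot> f = h \<cdot> (g \<cdot> f)"

locale additive_category = tri_category +
  assumes Hom_comm_group: "X \<in> Obj C \<Longrightarrow> Y \<in> Obj C \<Longrightarrow> comm_group (hom_group C X Y)"
    and Comp_Add_right: "f \<in> Hom C X Y \<Longrightarrow> f' \<in> Hom C X Y \<Longrightarrow> g \<in> Hom C Y Z
      \<Longrightarrow> g \<cdot> Add C f f' = Add C (g \<cdot> f) (g \<cdot> f')"
    and Comp_Add_left: "f \<in> Hom C X Y \<Longrightarrow> g \<in> Hom C Y Z \<Longrightarrow> g' \<in> Hom C Y Z
      \<Longrightarrow> Add C g g' \<cdot> f = Add C (g \<cdot> f) (g' \<cdot> f)"
    and zero_object_exists: "\<exists>Z. zero_object C Z"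
    and biproduct_exists: "X \<in> Obj C \<Longrightarrow> Y \<in> Obj C \<Longrightarrow> \<exists>B i j p q. biproduct C X Y B i j p q"

text \<open>
  Suspension is an additive self-equivalence with quasi-inverse desuspension; this includes the
  convention that it is an automorphism and desuspension its inverse.
\<close>

locale suspended_category = additive_category +
  assumes SuspO_Obj: "X \<in> Obj C \<Longrightarrow> SuspO C X \<in> Obj C"
    and SuspA_Hom: "f \<in> Hom C X Y \<Longrightarrow> SuspA C f \<in> Hom C (SuspO C X) (SuspO C Y)"
    and SuspA_Ident: "X \<in> Obj C \<Longrightarrow> SuspA C (Ident C X) = Ident C (SuspO C X)"
    and SuspA_Comp: "f \<in> Hom C X Y \<Longrightarrow> g \<in> Hom C Y Z
      \<Longrightarrow> SuspA C (g \<cdot> f) = SuspA C g \<cdot> SuspA C f"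
    and SuspA_Add: "f \<in> Hom C X Y \<Longrightarrow> g \<in> Hom C X Y
      \<Longrightarrow> SuspA C (Add C f g) = Add C (SuspA C f) (SuspA C g)"
    and DesO_Obj: "X \<in> Obj C \<Longrightarrow> DesO C X \<in> Obj C"
    and DesA_Hom: "f \<in> Hom C X Y \<Longrightarrow> DesA C f \<in> Hom C (DesO C X) (DesO C Y)"
    and DesA_Ident: "X \<in> Obj C \<Longrightarrow> DesA C (Ident C X) = Ident C (DesO C X)"
    and DesA_Comp: "f \<in> Hom C X Y \<Longrightarrow> g \<in> Hom C Y Z
      \<Longrightarrow> DesA C (g \<cdot> f) = DesA C g \<cdot> DesA C f"
    and unit_exists: "\<exists>\<eta>.
      (\<forall>X \<in> Obj C. \<eta> X \<in> Hom C X (DesO C (SuspO C X)) \<and> is_iso C (\<eta> X)) \<and>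
      (\<forall>X Y. \<forall>f \<in> Hom C X Y. DesA C (SuspA C f) \<cdot> \<eta> X = \<eta> Y \<cdot> f)"
    and counit_exists: "\<exists>\<epsilon>.
      (\<forall>X \<in> Obj C. \<epsilon> X \<in> Hom C (SuspO C (DesO C X)) X \<and> is_iso C (\<epsilon> X)) \<and>
      (\<forall>X Y. \<forall>f \<in> Hom C X Y. f \<cdot> \<epsilon> X = \<epsilon> Y \<cdot> SuspA C (DesA C f))"

definition is_triangle ::
  "('o, 'a, 'm) tricat_scheme \<Rightarrow> 'o \<Rightarrow> 'o \<Rightarrow> 'o \<Rightarrow> 'a \<Rightarrow> 'a \<Rightarrow> 'a \<Rightarrow> bool" where
  "is_triangle C X Y Z f g h \<longleftrightarrow> f \<in> Hom C X Y \<and> g \<in> Hom C Y Z \<and> h \<in> Hom C Z (SuspO C X)"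

definition triangle_morphism ::
  "('o, 'a, 'm) tricat_scheme \<Rightarrow> 'a \<times> 'a \<times> 'a \<Rightarrow> 'a \<times> 'a \<times> 'a \<Rightarrow> 'a \<Rightarrow> 'a \<Rightarrow> 'a \<Rightarrow> bool" where
  "triangle_morphism C = (\<lambda>(f, g, h) (f', g', h') a b c.
     a \<in> Hom C (Dom C f) (Dom C f') \<and> b \<in> Hom C (Dom C g) (Dom C g') \<and>
     c \<in> Hom C (Dom C h) (Dom C h') \<and>
     b \<cdot>\<^bsub>C\<^esub> f = f' \<cdot>\<^bsub>C\<^esub> a \<and> c \<cdot>\<^bsub>C\<^esub> g = g' \<cdot>\<^bsub>C\<^esub> b \<and> SuspA C a \<cdot>\<^bsub>C\<^esub> h = h' \<cdot>\<^bsub>C\<^esub> c)"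

text \<open>
  Verdier's axioms. In the octahedral axiom \<open>U\<close>, \<open>V\<close>, \<open>W\<close> are cofibres of \<open>f\<close>, \<open>g \<cdot> f\<close> and \<open>g\<close>.
\<close>

locale triangulated_category = suspended_category +
  assumes Tri_is_triangle: "(f, g, h) \<in> Tri C \<Longrightarrow> \<exists>X Y Z. is_triangle C X Y Z f g h"
    and Tri_iso: "(f, g, h) \<in> Tri C \<Longrightarrow> is_triangle C X' Y' Z' f' g' h'
      \<Longrightarrow> triangle_morphism C (f, g, h) (f', g', h') a b c
      \<Longrightarrow> is_iso C a \<Longrightarrow> is_iso C b \<Longrightarrow> is_iso C c \<Longrightarrow> (f', g', h') \<in> Tri C"
    and Tri_Ident: "X \<in> Obj C \<Longrightarrow> zero_object C Z
      \<Longrightarrow> (Ident C X, Zero C X Z, Zero C Z (SuspO C X)) \<in> Tri C"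
    and Tri_exists: "f \<in> Arr C \<Longrightarrow> \<exists>g h. (f, g, h) \<in> Tri C"
    and Tri_rotate: "is_triangle C X Y Z f g h
      \<Longrightarrow> (f, g, h) \<in> Tri C \<longleftrightarrow> (g, h, Neg C (SuspA C f)) \<in> Tri C"
    and Tri_complete: "(f, g, h) \<in> Tri C \<Longrightarrow> (f', g', h') \<in> Tri C
      \<Longrightarrow> a \<in> Hom C (Dom C f) (Dom C f') \<Longrightarrow> b \<in> Hom C (Dom C g) (Dom C g')
      \<Longrightarrow> b \<cdot> f = f' \<cdot> a \<Longrightarrow> \<exists>c. triangle_morphism C (f, g, h) (f', g', h') a b c"
    and octahedral: "f \<in> Hom C X Y \<Longrightarrow> g \<in> Hom C Y Z
      \<Longrightarrow> is_triangle C X Y U f f' f'' \<Longrightarrow> (f, f', f'') \<in> Tri C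
      \<Longrightarrow> is_triangle C Y Z W g g' g'' \<Longrightarrow> (g, g', g'') \<in> Tri C
      \<Longrightarrow> is_triangle C X Z V (g \<cdot> f) k' k'' \<Longrightarrow> (g \<cdot> f, k', k'') \<in> Tri C
      \<Longrightarrow> \<exists>u v. u \<in> Hom C U V \<and> v \<in> Hom C V W \<and> (u, v, SuspA C f' \<cdot> g'') \<in> Tri C \<and>
            u \<cdot> f' = k' \<cdot> g \<and> k'' \<cdot> u = f'' \<and> v \<cdot> k' = g' \<and> g'' \<cdot> v = SuspA C f \<cdot> k''"

definition cofibre_sequence :: "('o, 'a, 'm) tricat_scheme \<Rightarrow> 'a \<Rightarrow> 'a \<Rightarrow> bool" where
  "cofibre_sequence C f g \<longleftrightarrow> (\<exists>h. (f, g, h) \<in> Tri C)"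

definition null :: "('o, 'a, 'm) tricat_scheme \<Rightarrow> 'o set \<Rightarrow> 'a set" where
  "null C \<P> = {f \<in> Arr C. \<forall>P \<in> \<P>. \<forall>g \<in> Hom C P (Dom C f). f \<cdot>\<^bsub>C\<^esub> g = Zero C P (Cod C f)}"

definition proj :: "('o, 'a, 'm) tricat_scheme \<Rightarrow> 'a set \<Rightarrow> 'o set" where
  "proj C \<I> = {P \<in> Obj C. \<forall>f \<in> \<I>. \<forall>g \<in> Hom C P (Dom C f). f \<cdot>\<^bsub>C\<^esub> g = Zero C P (Cod C f)}"

definition projective_class ::
  "('o, 'a, 'm) tricat_scheme \<Rightarrow> 'o set \<Rightarrow> 'a set \<Rightarrow> bool" where
  "projective_class C \<P> \<I> \<longleftrightarrow>
     \<P> \<subseteq> Obj C \<and> \<I> \<subseteq> Arr C \<and> null C \<P> = \<I> \<and> proj C \<I> = \<P> \<and>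
     (\<forall>X \<in> Obj C. \<exists>P \<in> \<P>. \<exists>Y. \<exists>p \<in> Hom C P X. \<exists>f \<in> Hom C X Y.
        f \<in> \<I> \<and> cofibre_sequence C p f)"

definition stable_projective_class ::
  "('o, 'a, 'm) tricat_scheme \<Rightarrow> 'o set \<Rightarrow> 'a set \<Rightarrow> bool" where
  "stable_projective_class C \<P> \<I> \<longleftrightarrow> projective_class C \<P> \<I> \<and>
     (\<forall>P \<in> \<P>. SuspO C P \<in> \<P> \<and> DesO C P \<in> \<P>) \<and>
     (\<forall>f \<in> \<I>. SuspA C f \<in> \<I> \<and> DesA C f \<in> \<I>)"

definition ideal_product :: "('o, 'a, 'm) tricat_scheme \<Rightarrow> 'a set \<Rightarrow> 'a set \<Rightarrow> 'a set" where
  "ideal_product C \<I> \<J> = {f \<cdot>\<^bsub>C\<^esub> g | f g. f \<in> \<I> \<and> g \<in> \<J> \<and> Dom C f = Cod C g}"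

definition retracts_of_extensions ::
  "('o, 'a, 'm) tricat_scheme \<Rightarrow> 'o set \<Rightarrow> 'o set \<Rightarrow> 'o set" where
  "retracts_of_extensions C \<Q> \<P> =
     {Y \<in> Obj C. \<exists>X \<in> Obj C. retract_of C Y X \<and>
        (\<exists>Q \<in> \<Q>. \<exists>P \<in> \<P>. \<exists>u \<in> Hom C Q X. \<exists>v \<in> Hom C X P. cofibre_sequence C u v)}"

end

theory Submission
  imports Defs
begin

text \<open>
  To resolve an object \<open>X\<close> with respect to \<open>\<I>\<J>\<close>, choose \<open>Q \<rightarrow> X \<rightarrow> Y\<close> with \<open>Q\<close> in \<open>\<Q>\<close> and
  \<open>g: X \<rightarrow> Y\<close> in \<open>\<J>\<close>, then \<open>P \<rightarrow> Y \<rightarrow> Z\<close> with \<open>P\<close> in \<open>\<P>\<close> and \<open>f: Y \<rightarrow> Z\<close> in \<open>\<I>\<close>. By the octahedral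
  axiom the fibre \<open>F\<close> of \<open>f \<cdot> g\<close> lies in a cofibre sequence \<open>Q \<rightarrow> F \<rightarrow> P\<close>
  (\<open>fibre_of_composite\<close>, \<open>product_resolution\<close>). Conversely, every map of \<open>\<I>\<J>\<close> kills all maps out of
  such an extension: the first factor kills the part coming from \<open>Q\<close>, the second factor
  what is left on \<open>P\<close> (\<open>ideal_product_kills_extensions\<close>).

  These two facts determine both halves of the projective class. A map out of \<open>X\<close> that kills all
  extensions kills \<open>F \<rightarrow> X\<close>, hence factors through \<open>f \<cdot> g\<close> and lies in the ideal. If all maps of \<open>\<I>\<J>\<close>
  vanish on \<open>X\<close>, then \<open>f \<cdot> g = 0\<close>, so the identity of \<open>X\<close> lifts to \<open>F\<close> and \<open>X\<close> is a retract of \<open>F\<close>. The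
  factorisations used are the weak kernel and weak cokernel properties of exact triangles.

  Suspension is only an equivalence of categories, so fibres are obtained by desuspending cofibres
  with the help of its fullness and faithfulness (\<open>fibre_exists\<close>, \<open>Tri_desuspend\<close>). In the stable case
  \<open>\<I>\<J>\<close> is closed under suspension and desuspension because both are functors, and the projectives
  inherit this from the ideal (\<open>stable_projective_classI\<close>).
\<close>

section \<open>Arrows and zero maps\<close>

context tri_category
begin

lemma Hom_Obj: "f \<in> Hom C X Y \<Longrightarrow> X \<in> Obj C \<and> Y \<in> Obj C"
  using Dom_Obj Cod_Obj by (auto simp: Hom_def)

lemma Hom_DomCod: "f \<in> Hom C X Y \<Longrightarrow> Dom C f = X" "f \<in> Hom C X Y \<Longrightarrow> Cod C f = Y"
  by (auto simp: Hom_def)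

lemma Arr_Hom: "f \<in> Arr C \<longleftrightarrow> f \<in> Hom C (Dom C f) (Cod C f)"
  by (auto simp: Hom_def)

lemma is_iso_inverse:
  assumes "is_iso C f" "f \<in> Hom C X Y"
  obtains g where "g \<in> Hom C Y X" "g \<cdot> f = Ident C X" "f \<cdot> g = Ident C Y"
  using assms by (auto simp: is_iso_def Hom_DomCod)

lemma is_isoI:
  assumes "f \<in> Hom C X Y" "g \<in> Hom C Y X" "g \<cdot> f = Ident C X" "f \<cdot> g = Ident C Y"
  shows "is_iso C f"
  using assms unfolding is_iso_def by (auto simp: Hom_DomCod) (auto simp: Hom_def)

lemma is_iso_Ident: "X \<in> Obj C \<Longrightarrow> is_iso C (Ident C X)"
  by (metis is_isoI Ident_Hom Comp_Ident_right)

lemma Comp_cancel: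
  assumes "g' \<in> Hom C Y X" "g \<cdot> g' = Ident C Y" "g \<in> Hom C X Y" "f \<in> Hom C Y Z"
  shows "(f \<cdot> g) \<cdot> g' = f"
  using Comp_assoc[OF assms(1,3,4)] assms(2) Comp_Ident_right[OF assms(4)] by simp

lemma iso_right_cancel:
  assumes "is_iso C e" "e \<in> Hom C X Y" "f \<in> Hom C Y Z" "f' \<in> Hom C Y Z" "f \<cdot> e = f' \<cdot> e"
  shows "f = f'"
proof -
  obtain e' where e': "e' \<in> Hom C Y X" "e' \<cdot> e = Ident C X" "e \<cdot> e' = Ident C Y"
    by (rule is_iso_inverse[OF assms(1,2)])
  show ?thesis
    using Comp_cancel[OF e'(1,3) assms(2,3)] Comp_cancel[OF e'(1,3) assms(2,4)] assms(5) by metis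
qed

lemma iso_left_cancel:
  assumes "is_iso C e" "e \<in> Hom C Y Z" "f \<in> Hom C X Y" "f' \<in> Hom C X Y" "e \<cdot> f = e \<cdot> f'"
  shows "f = f'"
proof -
  obtain e' where e': "e' \<in> Hom C Z Y" "e' \<cdot> e = Ident C Y" "e \<cdot> e' = Ident C Z"
    by (rule is_iso_inverse[OF assms(1,2)])
  have "e' \<cdot> (e \<cdot> f) = f" "e' \<cdot> (e \<cdot> f') = f'"
    using Comp_assoc[OF assms(3,2) e'(1)] Comp_assoc[OF assms(4,2) e'(1)] e'(2)
      Comp_Ident_left[OF assms(3)] Comp_Ident_left[OF assms(4)] by simp_all
  then show ?thesis using assms(5) by metis
qed

end

context additive_category
begin

lemma hom_group: "X \<in> Obj C \<Longrightarrow> Y \<in> Obj C \<Longrightarrow> group (hom_group C X Y)"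
  using Hom_comm_group comm_group.axioms(2) by blast

lemma Zero_Hom: "X \<in> Obj C \<Longrightarrow> Y \<in> Obj C \<Longrightarrow> Zero C X Y \<in> Hom C X Y"
  using group.is_monoid[OF hom_group, THEN monoid.one_closed] by (simp add: hom_group_def)

lemma Neg_Hom: "f \<in> Hom C X Y \<Longrightarrow> Neg C f \<in> Hom C X Y"
  using group.inv_closed[OF hom_group, of X Y f] Hom_Obj
  by (auto simp: Neg_def Hom_DomCod) (simp add: hom_group_def)

lemma Add_idem_Zero: "f \<in> Hom C X Y \<Longrightarrow> Add C f f = f \<Longrightarrow> f = Zero C X Y"
  using group.r_cancel_one[OF hom_group, of X Y f f] Hom_Obj by (simp add: hom_group_def)

lemma Zero_Add: "f \<in> Hom C X Y \<Longrightarrow> Add C (Zero C X Y) f = f"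
  using group.is_monoid[OF hom_group, THEN monoid.l_one, of X Y f] Hom_Obj
  by (simp add: hom_group_def)

lemma Add_Neg: "f \<in> Hom C X Y \<Longrightarrow> Add C f (Neg C f) = Zero C X Y"
  using group.r_inv[OF hom_group, of X Y f] Hom_Obj
  by (auto simp: Neg_def Hom_DomCod) (simp add: hom_group_def)

lemma Neg_unique:
  assumes "f \<in> Hom C X Y" "g \<in> Hom C X Y" "Add C g f = Zero C X Y"
  shows "Neg C f = g"
  using group.inv_equality[OF hom_group, of X Y g f] Hom_Obj[OF assms(1)] assms
  by (simp add: Neg_def Hom_DomCod hom_group_def)

lemma Neg_Neg: "f \<in> Hom C X Y \<Longrightarrow> Neg C (Neg C f) = f"
  by (meson Add_Neg Neg_Hom Neg_unique)

lemma Comp_Zero: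
  assumes "g \<in> Hom C Y Z" "X \<in> Obj C"
  shows "g \<cdot> Zero C X Y = Zero C X Z"
proof -
  have z: "Zero C X Y \<in> Hom C X Y" using assms Hom_Obj Zero_Hom by blast
  show ?thesis
    using Add_idem_Zero[OF Comp_Hom[OF z assms(1)]] Comp_Add_right[OF z z assms(1)] Zero_Add[OF z]
    by simp
qed

lemma Zero_Comp:
  assumes "f \<in> Hom C X Y" "Z \<in> Obj C"
  shows "Zero C Y Z \<cdot> f = Zero C X Z"
proof -
  have z: "Zero C Y Z \<in> Hom C Y Z" using assms Hom_Obj Zero_Hom by blast
  show ?thesis
    using Add_idem_Zero[OF Comp_Hom[OF assms(1) z]] Comp_Add_left[OF assms(1) z z] Zero_Add[OF z]
    by simp
qed

lemma Add_Neg_left: "f \<in> Hom C X Y \<Longrightarrow> Add C (Neg C f) f = Zero C X Y"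
  using Add_Neg[OF Neg_Hom, of f X Y] Neg_Neg[of f X Y] by simp

lemma Comp_Neg:
  assumes "f \<in> Hom C X Y" "g \<in> Hom C Y Z"
  shows "g \<cdot> Neg C f = Neg C (g \<cdot> f)"
proof -
  have "Add C (g \<cdot> Neg C f) (g \<cdot> f) = Zero C X Z"
    using Comp_Add_right[OF Neg_Hom[OF assms(1)] assms] Add_Neg_left[OF assms(1)]
      Comp_Zero[OF assms(2)] Hom_Obj[OF assms(1)] by simp
  then show ?thesis
    using Neg_unique[OF Comp_Hom[OF assms] Comp_Hom[OF Neg_Hom[OF assms(1)] assms(2)]] by simp
qed

lemma Neg_Comp:
  assumes "f \<in> Hom C X Y" "g \<in> Hom C Y Z"
  shows "Neg C g \<cdot> f = Neg C (g \<cdot> f)"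
proof -
  have "Add C (Neg C g \<cdot> f) (g \<cdot> f) = Zero C X Z"
    using Comp_Add_left[OF assms(1) Neg_Hom[OF assms(2)] assms(2)] Add_Neg_left[OF assms(2)]
      Zero_Comp[OF assms(1)] Hom_Obj[OF assms(2)] by simp
  then show ?thesis
    using Neg_unique[OF Comp_Hom[OF assms] Comp_Hom[OF assms(1) Neg_Hom[OF assms(2)]]] by simp
qed

lemma Neg_inject: "f \<in> Hom C X Y \<Longrightarrow> g \<in> Hom C X Y \<Longrightarrow> Neg C f = Neg C g \<Longrightarrow> f = g"
  using Neg_Neg by metis

lemma is_iso_Neg_Ident:
  assumes "X \<in> Obj C"
  shows "is_iso C (Neg C (Ident C X))"
  by (rule is_isoI[of _ X X "Neg C (Ident C X)"])
    (use assms in \<open>auto simp: Neg_Hom Ident_Hom Comp_Neg[of _ X X _ X] Neg_Comp[of _ X X _ X]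
      Comp_Ident_right[of _ X X] Neg_Neg[of _ X X]\<close>)

lemma zero_object_Ident: "zero_object C Z \<Longrightarrow> Ident C Z = Zero C Z Z"
  unfolding zero_object_def using Ident_Hom Zero_Hom by blast

lemma zero_objectI:
  assumes "Z \<in> Obj C" "Ident C Z = Zero C Z Z"
  shows "zero_object C Z"
proof -
  have "f = Zero C X Z" if "f \<in> Hom C X Z" for f X
    using Comp_Ident_left[OF that] Zero_Comp[OF that assms(1)] assms(2) by simp
  moreover have "f = Zero C Z X" if "f \<in> Hom C Z X" for f X
    using Comp_Ident_right[OF that] Comp_Zero[OF that assms(1)] assms(2) by simp
  ultimately show ?thesis
    unfolding zero_object_def using assms(1) Zero_Hom by blast
qed

end

section \<open>The suspension functor\<close>

context suspended_category
begin

lemma unit: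
  obtains \<eta> where "\<And>X. X \<in> Obj C \<Longrightarrow> \<eta> X \<in> Hom C X (DesO C (SuspO C X))"
    "\<And>X. X \<in> Obj C \<Longrightarrow> is_iso C (\<eta> X)"
    "\<And>X Y f. f \<in> Hom C X Y \<Longrightarrow> DesA C (SuspA C f) \<cdot> \<eta> X = \<eta> Y \<cdot> f"
  using unit_exists by blast

lemma counit:
  obtains \<epsilon> where "\<And>X. X \<in> Obj C \<Longrightarrow> \<epsilon> X \<in> Hom C (SuspO C (DesO C X)) X"
    "\<And>X. X \<in> Obj C \<Longrightarrow> is_iso C (\<epsilon> X)"
    "\<And>X Y f. f \<in> Hom C X Y \<Longrightarrow> f \<cdot> \<epsilon> X = \<epsilon> Y \<cdot> SuspA C (DesA C f)"
  using counit_exists by blast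

lemma SuspA_faithful:
  assumes "f \<in> Hom C X Y" "f' \<in> Hom C X Y" "SuspA C f = SuspA C f'"
  shows "f = f'"
proof -
  obtain \<eta> where e: "\<And>X. X \<in> Obj C \<Longrightarrow> \<eta> X \<in> Hom C X (DesO C (SuspO C X))"
    "\<And>X. X \<in> Obj C \<Longrightarrow> is_iso C (\<eta> X)"
    "\<And>X Y f. f \<in> Hom C X Y \<Longrightarrow> DesA C (SuspA C f) \<cdot> \<eta> X = \<eta> Y \<cdot> f"
    using unit by blast
  have "\<eta> Y \<cdot> f = \<eta> Y \<cdot> f'" using e(3) assms by metis
  then show ?thesis using iso_left_cancel e(1,2) assms Hom_Obj by meson
qed

lemma DesA_faithful:
  assumes "f \<in> Hom C X Y" "f' \<in> Hom C X Y" "DesA C f = DesA C f'"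
  shows "f = f'"
proof -
  obtain \<epsilon> where e: "\<And>X. X \<in> Obj C \<Longrightarrow> \<epsilon> X \<in> Hom C (SuspO C (DesO C X)) X"
    "\<And>X. X \<in> Obj C \<Longrightarrow> is_iso C (\<epsilon> X)"
    "\<And>X Y f. f \<in> Hom C X Y \<Longrightarrow> f \<cdot> \<epsilon> X = \<epsilon> Y \<cdot> SuspA C (DesA C f)"
    using counit by blast
  have "f \<cdot> \<epsilon> X = f' \<cdot> \<epsilon> X" using e(3) assms by metis
  then show ?thesis using iso_right_cancel e(1,2) assms Hom_Obj by meson
qed

text \<open>The preimage of \<open>h\<close> is its desuspension conjugated by the unit; faithfulness of desuspension
  turns the naturality of the unit into the required equation.\<close>

lemma SuspA_full:
  assumes "X \<in> Obj C" "Y \<in> Obj C" "h \<in> Hom C (SuspO C X) (SuspO C Y)"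
  obtains f where "f \<in> Hom C X Y" "SuspA C f = h"
proof -
  obtain \<eta> where e: "\<And>X. X \<in> Obj C \<Longrightarrow> \<eta> X \<in> Hom C X (DesO C (SuspO C X))"
    "\<And>X. X \<in> Obj C \<Longrightarrow> is_iso C (\<eta> X)"
    "\<And>X Y f. f \<in> Hom C X Y \<Longrightarrow> DesA C (SuspA C f) \<cdot> \<eta> X = \<eta> Y \<cdot> f"
    using unit by blast
  obtain t where t: "t \<in> Hom C (DesO C (SuspO C Y)) Y" "\<eta> Y \<cdot> t = Ident C (DesO C (SuspO C Y))"
    using is_iso_inverse e(1,2) assms(2) by metis
  let ?f = "t \<cdot> (DesA C h \<cdot> \<eta> X)"
  have D: "DesA C h \<cdot> \<eta> X \<in> Hom C X (DesO C (SuspO C Y))"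
    using Comp_Hom DesA_Hom assms e(1) by meson
  have f: "?f \<in> Hom C X Y" using Comp_Hom D t(1) by meson
  have "\<eta> Y \<cdot> ?f = DesA C h \<cdot> \<eta> X"
    using Comp_assoc[OF D t(1) e(1)[OF assms(2)]] t(2) Comp_Ident_left[OF D] by simp
  then have "DesA C (SuspA C ?f) \<cdot> \<eta> X = DesA C h \<cdot> \<eta> X" using e(3) f by metis
  then have "DesA C (SuspA C ?f) = DesA C h"
    using iso_right_cancel e(1,2) assms f DesA_Hom SuspA_Hom by meson
  then have "SuspA C ?f = h" using DesA_faithful f SuspA_Hom assms(3) by meson
  with f that show thesis by blast
qed

lemma SuspA_Zero:
  assumes "X \<in> Obj C" "Y \<in> Obj C"
  shows "SuspA C (Zero C X Y) = Zero C (SuspO C X) (SuspO C Y)"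
  using Add_idem_Zero[OF SuspA_Hom[OF Zero_Hom[OF assms]]]
    SuspA_Add[OF Zero_Hom[OF assms] Zero_Hom[OF assms]] Zero_Add[OF Zero_Hom[OF assms]] by simp

lemma zero_object_SuspO:
  assumes "zero_object C Z"
  shows "zero_object C (SuspO C Z)"
proof (rule zero_objectI)
  have "Z \<in> Obj C" using assms by (simp add: zero_object_def)
  then show "SuspO C Z \<in> Obj C" "Ident C (SuspO C Z) = Zero C (SuspO C Z) (SuspO C Z)"
    using SuspO_Obj SuspA_Ident SuspA_Zero zero_object_Ident[OF assms] by metis+
qed

end

section \<open>Exact triangles\<close>

context triangulated_category
begin

lemma Tri_HomD:
  assumes "(f, g, h) \<in> Tri C" "f \<in> Hom C X Y" "g \<in> Hom C Y Z"
  shows "is_triangle C X Y Z f g h"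
  using Tri_is_triangle[OF assms(1)] assms by (auto simp: is_triangle_def Hom_def)

lemma Tri_rotateD:
  assumes "(f, g, h) \<in> Tri C" "is_triangle C X Y Z f g h"
  shows "(g, h, Neg C (SuspA C f)) \<in> Tri C"
    "is_triangle C Y Z (SuspO C X) g h (Neg C (SuspA C f))"
  using assms Tri_rotate by (auto simp: is_triangle_def intro: Neg_Hom SuspA_Hom)

lemma Tri_completeE:
  assumes T: "(f, g, h) \<in> Tri C" "is_triangle C X Y Z f g h"
    and T': "(f', g', h') \<in> Tri C" "is_triangle C X' Y' Z' f' g' h'"
    and ab: "a \<in> Hom C X X'" "b \<in> Hom C Y Y'" "b \<cdot> f = f' \<cdot> a"
  obtains c where "c \<in> Hom C Z Z'" "c \<cdot> g = g' \<cdot> b" "SuspA C a \<cdot> h = h' \<cdot> c"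
proof -
  have D: "Dom C f = X" "Dom C g = Y" "Dom C h = Z" "Dom C f' = X'" "Dom C g' = Y'" "Dom C h' = Z'"
    using T(2) T'(2) by (simp_all add: is_triangle_def Hom_def)
  show thesis
    using Tri_complete[OF T(1) T'(1), of a b] ab that by (auto simp: D triangle_morphism_def)
qed

text \<open>The second arrow of an exact triangle is a weak cokernel of the first: an arrow \<open>k\<close> with
  \<open>k \<cdot> u = 0\<close> is the middle part of a morphism to the triangle \<open>0 \<rightarrow> D \<rightarrow> D \<rightarrow> \<Sigma>0\<close>, which is exact because
  rotating it gives the triangle of an identity, \<open>\<Sigma>0\<close> being a zero object.\<close>

lemma Tri_weak_cokernel:
  assumes T: "(u, v, w) \<in> Tri C" "is_triangle C A B E u v w"
    and k: "k \<in> Hom C B D" "k \<cdot> u = Zero C A D"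
  obtains t where "t \<in> Hom C E D" "t \<cdot> v = k"
proof -
  obtain Z where Z: "zero_object C Z" using zero_object_exists by blast
  have ob: "A \<in> Obj C" "D \<in> Obj C" "Z \<in> Obj C" "SuspO C Z \<in> Obj C" "SuspO C D \<in> Obj C"
    using T(2) k(1) Hom_Obj Z SuspO_Obj by (auto simp: is_triangle_def zero_object_def)
  have tri: "is_triangle C Z D D (Zero C Z D) (Ident C D) (Zero C D (SuspO C Z))"
    using ob by (simp add: is_triangle_def Zero_Hom Ident_Hom)
  have "Neg C (SuspA C (Zero C Z D)) = Zero C (SuspO C Z) (SuspO C D)"
    using ob SuspA_Zero Neg_unique Zero_Add Zero_Hom by metis
  then have Z_tri: "(Zero C Z D, Ident C D, Zero C D (SuspO C Z)) \<in> Tri C"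
    using Tri_rotate[OF tri] Tri_Ident[OF ob(2) zero_object_SuspO[OF Z]] by simp
  have "k \<cdot> u = Zero C Z D \<cdot> Zero C A Z" using k(2) ob Comp_Zero Zero_Hom by metis
  then obtain c where "c \<in> Hom C E D" "c \<cdot> v = Ident C D \<cdot> k"
    using Tri_completeE[OF T Z_tri tri Zero_Hom[OF ob(1,3)] k(1)] by metis
  then show thesis using that Comp_Ident_left[OF k(1)] by metis
qed

text \<open>Dually, the first arrow is a weak kernel of the second. Completing a morphism of triangles
  supplies the third component, so the factorisation is found one suspension up, between rotated
  triangles, and desuspended by fullness and faithfulness.\<close>

lemma Tri_weak_kernel:
  assumes T: "(u, v, w) \<in> Tri C" "is_triangle C A B E u v w"
    and m: "m \<in> Hom C D B" "v \<cdot> m = Zero C D E"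
  obtains s where "s \<in> Hom C D A" "u \<cdot> s = m"
proof -
  obtain Z where Z: "zero_object C Z" using zero_object_exists by blast
  have ob: "A \<in> Obj C" "D \<in> Obj C" "Z \<in> Obj C" "E \<in> Obj C" "SuspO C D \<in> Obj C"
    using T(2) m(1) Hom_Obj Z SuspO_Obj by (auto simp: is_triangle_def zero_object_def)
  have u: "u \<in> Hom C A B" using T(2) by (simp add: is_triangle_def)
  let ?n = "Neg C (SuspA C (Ident C D))"
  have I: "(Zero C D Z, Zero C Z (SuspO C D), ?n) \<in> Tri C"
    "is_triangle C D Z (SuspO C D) (Zero C D Z) (Zero C Z (SuspO C D)) ?n"
    using Tri_rotateD[OF Tri_Ident[OF ob(2) Z], of D D Z] ob Zero_Hom Ident_Hom
    by (auto simp: is_triangle_def)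
  note R = Tri_rotateD[OF T]
  have "Zero C Z E \<cdot> Zero C D Z = v \<cdot> m" using m(2) ob Comp_Zero Zero_Hom by metis
  then obtain c where
    c: "c \<in> Hom C (SuspO C D) (SuspO C A)" "SuspA C m \<cdot> ?n = Neg C (SuspA C u) \<cdot> c"
    using Tri_completeE[OF I R m(1) Zero_Hom[OF ob(3,4)]] by metis
  obtain s where s: "s \<in> Hom C D A" "SuspA C s = c" using SuspA_full ob c(1) by metis
  have us: "u \<cdot> s \<in> Hom C D B" using Comp_Hom s(1) u by meson
  have "Neg C (SuspA C m) = SuspA C m \<cdot> ?n"
    using Comp_Neg Comp_Ident_right SuspA_Ident SuspA_Hom Ident_Hom m(1) ob by metis
  also have "\<dots> = Neg C (SuspA C (u \<cdot> s))"
    using c(2) s SuspA_Comp[OF s(1) u] Neg_Comp SuspA_Hom u by metis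
  finally have "SuspA C m = SuspA C (u \<cdot> s)" using Neg_inject SuspA_Hom m(1) us by meson
  then have "u \<cdot> s = m" using SuspA_faithful[OF m(1) us] by simp
  with s(1) show thesis by (rule that)
qed

text \<open>The candidate for the fibre is the desuspension of the cofibre. The sign in the rotation axiom
  is absorbed by choosing the arrow whose negated suspension is the given connecting arrow.\<close>

lemma fibre_exists:
  assumes f: "f \<in> Hom C X Y"
  obtains F e h where "e \<in> Hom C F X" "is_triangle C F X Y e f h" "(e, f, h) \<in> Tri C"
proof -
  obtain g d where T: "(f, g, d) \<in> Tri C" using Tri_exists[of f] f by (auto simp: Hom_def)
  then obtain V where V: "is_triangle C X Y V f g d"
    using Tri_is_triangle[OF T] f by (auto simp: is_triangle_def Hom_def)
  have gd: "g \<in> Hom C Y V" "d \<in> Hom C V (SuspO C X)" using V by (auto simp: is_triangle_def)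
  have ob: "X \<in> Obj C" "Y \<in> Obj C" "V \<in> Obj C" using gd f Hom_Obj by auto
  define F where "F = DesO C V"
  have F: "F \<in> Obj C" using ob DesO_Obj F_def by simp
  obtain e where e: "e \<in> Hom C (SuspO C F) V" "is_iso C e" using counit ob(3) F_def by metis
  obtain e' where e': "e' \<in> Hom C V (SuspO C F)" "e' \<cdot> e = Ident C (SuspO C F)" "e \<cdot> e' = Ident C V"
    using is_iso_inverse e by metis
  have iso: "is_iso C e'" using is_isoI e e' by metis
  have de: "d \<cdot> e \<in> Hom C (SuspO C F) (SuspO C X)" using Comp_Hom e(1) gd(2) by meson
  obtain r where r: "r \<in> Hom C F X" "SuspA C r = Neg C (d \<cdot> e)"
    using SuspA_full F ob(1) Neg_Hom[OF de] by metis
  have r': "Neg C (SuspA C r) = d \<cdot> e" using r(2) Neg_Neg de by metis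
  have e'g: "e' \<cdot> g \<in> Hom C Y (SuspO C F)" using Comp_Hom gd(1) e'(1) by meson
  have tri: "is_triangle C X Y (SuspO C F) f (e' \<cdot> g) (d \<cdot> e)"
    using f e'g de by (simp add: is_triangle_def)
  have "triangle_morphism C (f, g, d) (f, e' \<cdot> g, d \<cdot> e) (Ident C X) (Ident C Y) e'"
    using f gd e'g de e' ob
    by (simp add: triangle_morphism_def Hom_DomCod[OF f] Hom_DomCod[OF gd(1)] Hom_DomCod[OF gd(2)]
        Hom_DomCod[OF e'g] Hom_DomCod[OF de] Ident_Hom Comp_Ident_left[OF f] Comp_Ident_right[OF f]
        Comp_Ident_right[OF e'g] SuspA_Ident Comp_Ident_left[OF gd(2)] Comp_cancel[OF e'(1) e'(3) e(1) gd(2)])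
  then have "(f, e' \<cdot> g, Neg C (SuspA C r)) \<in> Tri C"
    using Tri_iso[OF T tri] is_iso_Ident ob iso r' by metis
  moreover have tri': "is_triangle C F X Y r f (e' \<cdot> g)"
    using r(1) f e'g by (simp add: is_triangle_def)
  ultimately have "(r, f, e' \<cdot> g) \<in> Tri C" using Tri_rotate by metis
  with r(1) tri' show thesis by (rule that)
qed

text \<open>Rotating three times gives \<open>(- \<Sigma>a, - \<Sigma>b, - \<Sigma>c)\<close>, and negating the middle object removes two
  of the three signs.\<close>

lemma Tri_desuspend:
  assumes t: "is_triangle C Q F P a b c"
    and T: "(SuspA C a, SuspA C b, Neg C (SuspA C c)) \<in> Tri C"
  shows "(a, b, c) \<in> Tri C"
proof -
  have abc: "a \<in> Hom C Q F" "b \<in> Hom C F P" "c \<in> Hom C P (SuspO C Q)"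
    using t by (auto simp: is_triangle_def)
  note S = SuspA_Hom[OF abc(1)] SuspA_Hom[OF abc(2)] SuspA_Hom[OF abc(3)]
  note N = Neg_Hom[OF S(1)] Neg_Hom[OF S(2)] Neg_Hom[OF S(3)]
  have ob: "SuspO C Q \<in> Obj C" "SuspO C F \<in> Obj C" "SuspO C P \<in> Obj C" using S Hom_Obj by auto
  note I = Ident_Hom[OF ob(1)] Ident_Hom[OF ob(2)] Ident_Hom[OF ob(3)]
  let ?A = "Neg C (SuspA C a)" and ?B = "Neg C (SuspA C b)" and ?C = "Neg C (SuspA C c)"
  have "triangle_morphism C (SuspA C a, SuspA C b, ?C) (?A, ?B, ?C)
     (Ident C (SuspO C Q)) (Neg C (Ident C (SuspO C F))) (Ident C (SuspO C P))"
    using I N S Neg_Hom[OF I(2)] ob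
    by (simp add: triangle_morphism_def Hom_DomCod[OF S(1)] Hom_DomCod[OF S(2)]
        Hom_DomCod[OF N(1)] Hom_DomCod[OF N(2)] Hom_DomCod[OF N(3)]
        Neg_Comp[OF S(1) I(2)] Comp_Neg[OF I(2) N(2)] Comp_Ident_left[OF S(1)]
        Comp_Ident_right[OF N(1)] Comp_Ident_left[OF S(2)] Comp_Ident_right[OF N(2)]
        Neg_Neg[OF S(2)] SuspA_Ident
        Comp_Ident_left[OF N(3)] Comp_Ident_right[OF N(3)])
  then have "(?A, ?B, ?C) \<in> Tri C"
    using Tri_iso[OF T, of "SuspO C Q" "SuspO C F" "SuspO C P"] N ob
    by (simp add: is_triangle_def is_iso_Ident is_iso_Neg_Ident)
  then have "(c, ?A, ?B) \<in> Tri C"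
    using Tri_rotate[of P "SuspO C Q" "SuspO C F" c ?A ?B] abc N by (simp add: is_triangle_def)
  then have "(b, c, ?A) \<in> Tri C"
    using Tri_rotate[of F P "SuspO C Q" b c ?A] abc N by (simp add: is_triangle_def)
  then show ?thesis using Tri_rotate[OF t] by simp
qed

text \<open>The octahedral axiom relates cofibres, which after rotation are the suspensions of the fibres;
  the resulting triangle is then desuspended.\<close>

lemma fibre_of_composite:
  assumes g: "is_triangle C Q X Y q g y" "(q, g, y) \<in> Tri C"
    and f: "is_triangle C P Y Z p f z" "(p, f, z) \<in> Tri C"
    and fg: "is_triangle C F X Z e (f \<cdot> g) d" "(e, f \<cdot> g, d) \<in> Tri C"
  obtains a b where "a \<in> Hom C Q F" "b \<in> Hom C F P" "cofibre_sequence C a b"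
proof -
  have gH: "g \<in> Hom C X Y" "y \<in> Hom C Y (SuspO C Q)" and fH: "p \<in> Hom C P Y" "f \<in> Hom C Y Z"
    and eH: "e \<in> Hom C F X" and qH: "q \<in> Hom C Q X"
    using g f fg by (auto simp: is_triangle_def)
  have ob: "Q \<in> Obj C" "F \<in> Obj C" "P \<in> Obj C" using fH eH qH Hom_Obj by auto
  note R = Tri_rotateD[OF g(2,1)] Tri_rotateD[OF f(2,1)] Tri_rotateD[OF fg(2,1)]
  obtain u v where uv: "u \<in> Hom C (SuspO C Q) (SuspO C F)" "v \<in> Hom C (SuspO C F) (SuspO C P)"
    "(u, v, SuspA C y \<cdot> Neg C (SuspA C p)) \<in> Tri C"
    using octahedral[OF gH(1) fH(2) R(2,1,4,3,6,5)] by blast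
  obtain a where a: "a \<in> Hom C Q F" "SuspA C a = u" using SuspA_full ob uv(1) by metis
  obtain b where b: "b \<in> Hom C F P" "SuspA C b = v" using SuspA_full ob uv(2) by metis
  have "SuspA C y \<cdot> Neg C (SuspA C p) = Neg C (SuspA C (y \<cdot> p))"
    using Comp_Neg SuspA_Comp SuspA_Hom fH(1) gH(2) by metis
  moreover have "is_triangle C Q F P a b (y \<cdot> p)"
    using a b Comp_Hom fH(1) gH(2) by (auto simp: is_triangle_def)
  ultimately have "(a, b, y \<cdot> p) \<in> Tri C" using Tri_desuspend uv(3) a b by metis
  then have "cofibre_sequence C a b" by (auto simp: cofibre_sequence_def)
  with a(1) b(1) show thesis by (rule that)
qed

section \<open>Products of projective classes\<close>

lemma projective_class_zero:
  assumes "projective_class C \<P> \<I>" "P \<in> \<P>" "f \<in> \<I>" "f \<in> Hom C X Y" "g \<in> Hom C P X"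
  shows "f \<cdot> g = Zero C P Y"
  using assms unfolding projective_class_def null_def by (auto simp: Hom_DomCod)

lemma projective_class_left_ideal:
  assumes "projective_class C \<P> \<I>" "f \<in> \<I>" "f \<in> Hom C X Y" "t \<in> Hom C Y Z"
  shows "t \<cdot> f \<in> \<I>"
proof -
  have tf: "t \<cdot> f \<in> Hom C X Z" using Comp_Hom assms by meson
  have "(t \<cdot> f) \<cdot> g = Zero C P Z" if "P \<in> \<P>" "g \<in> Hom C P X" for P g
    using projective_class_zero[OF assms(1) that(1) assms(2,3) that(2)]
      Comp_assoc[OF that(2) assms(3,4)] Comp_Zero[OF assms(4)] Hom_Obj[OF that(2)] by simp
  then have "t \<cdot> f \<in> null C \<P>" using tf Arr_Hom by (auto simp: null_def Hom_DomCod[OF tf])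
  then show ?thesis using assms(1) by (simp add: projective_class_def)
qed

lemma projective_class_resolution:
  assumes "projective_class C \<P> \<I>" "X \<in> Obj C"
  obtains P Y p f h where "P \<in> \<P>" "f \<in> \<I>" "f \<in> Hom C X Y" "is_triangle C P X Y p f h"
    "(p, f, h) \<in> Tri C"
proof -
  obtain P Y p f where *: "P \<in> \<P>" "p \<in> Hom C P X" "f \<in> Hom C X Y" "f \<in> \<I>" "cofibre_sequence C p f"
    using assms unfolding projective_class_def by blast
  then show thesis using that Tri_HomD unfolding cofibre_sequence_def by metis
qed

lemma ideal_productE:
  assumes "projective_class C \<P> \<I>" "projective_class C \<Q> \<J>" "m \<in> ideal_product C \<I> \<J>"
  obtains f g X Y Z where "m = f \<cdot> g" "f \<in> \<I>" "g \<in> \<J>" "g \<in> Hom C X Y" "f \<in> Hom C Y Z"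
    "m \<in> Hom C X Z"
proof -
  obtain f g where m: "m = f \<cdot> g" "f \<in> \<I>" "g \<in> \<J>" "Dom C f = Cod C g"
    using assms(3) by (auto simp: ideal_product_def)
  then have "g \<in> Hom C (Dom C g) (Cod C g)" "f \<in> Hom C (Cod C g) (Cod C f)"
    using assms(1,2) by (auto simp: projective_class_def Hom_def)
  with m Comp_Hom that show thesis by blast
qed

lemma ideal_productI:
  "f \<in> \<I> \<Longrightarrow> g \<in> \<J> \<Longrightarrow> g \<in> Hom C X Y \<Longrightarrow> f \<in> Hom C Y Z \<Longrightarrow> f \<cdot> g \<in> ideal_product C \<I> \<J>"
  unfolding ideal_product_def using Hom_DomCod by blast

text \<open>On \<open>Q \<rightarrow> X \<rightarrow> P\<close> an arrow \<open>g \<in> \<J>\<close> kills what comes from \<open>Q\<close>, so what remains factors through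
  \<open>P\<close>, where \<open>f \<in> \<I>\<close> kills it; a retract inherits this from \<open>X\<close>.\<close>

lemma ideal_product_kills_extensions:
  assumes pc: "projective_class C \<P> \<I>" "projective_class C \<Q> \<J>"
    and W: "W \<in> retracts_of_extensions C \<Q> \<P>"
    and m: "m \<in> ideal_product C \<I> \<J>" "m \<in> Hom C A D" and x: "x \<in> Hom C W A"
  shows "m \<cdot> x = Zero C W D"
proof -
  obtain f g B where fg: "m = f \<cdot> g" "f \<in> \<I>" "g \<in> \<J>" "g \<in> Hom C A B" "f \<in> Hom C B D"
    using ideal_productE[OF pc m(1)] Hom_DomCod m(2) by metis
  obtain X Q P u v where ext: "retract_of C W X" "Q \<in> \<Q>" "P \<in> \<P>" "u \<in> Hom C Q X" "v \<in> Hom C X P"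
    "cofibre_sequence C u v"
    using W by (auto simp: retracts_of_extensions_def)
  obtain s r where sr: "s \<in> Hom C W X" "r \<in> Hom C X W" "r \<cdot> s = Ident C W"
    using ext(1) by (auto simp: retract_of_def)
  obtain w where T: "(u, v, w) \<in> Tri C" "is_triangle C Q X P u v w"
    using ext Tri_HomD unfolding cofibre_sequence_def by metis
  have D: "D \<in> Obj C" using m(2) Hom_Obj by blast
  have xr: "x \<cdot> r \<in> Hom C X A" using Comp_Hom sr(2) x by meson
  have gxr: "g \<cdot> (x \<cdot> r) \<in> Hom C X B" using Comp_Hom xr fg(4) by meson
  have "(g \<cdot> (x \<cdot> r)) \<cdot> u = g \<cdot> ((x \<cdot> r) \<cdot> u)" using Comp_assoc ext(4) xr fg(4) by meson
  also have "\<dots> = Zero C Q B"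
    using projective_class_zero[OF pc(2) ext(2) fg(3,4)] Comp_Hom ext(4) xr by meson
  finally obtain t where t: "t \<in> Hom C P B" "t \<cdot> v = g \<cdot> (x \<cdot> r)"
    using Tri_weak_cokernel[OF T gxr] by metis
  have "m \<cdot> (x \<cdot> r) = f \<cdot> (t \<cdot> v)" using fg(1) Comp_assoc[OF xr fg(4,5)] t(2) by simp
  also have "\<dots> = (f \<cdot> t) \<cdot> v" using Comp_assoc[OF ext(5) t(1) fg(5)] by simp
  also have "\<dots> = Zero C X D"
    using projective_class_zero[OF pc(1) ext(3) fg(2,5) t(1)] Zero_Comp[OF ext(5) D] by simp
  finally have "m \<cdot> (x \<cdot> r) = Zero C X D" .
  moreover have "(m \<cdot> (x \<cdot> r)) \<cdot> s = m \<cdot> x"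
    using Comp_assoc[OF sr(1) xr m(2)] Comp_assoc[OF sr(1,2) x] sr(3) Comp_Ident_right[OF x] by simp
  ultimately show ?thesis using Zero_Comp[OF sr(1) D] by simp
qed

text \<open>Resolve \<open>X\<close> with respect to \<open>\<J>\<close>, and its cofibre with respect to \<open>\<I>\<close>; the fibre of the
  composite is an extension of the two projectives.\<close>

lemma product_resolution:
  assumes pc: "projective_class C \<P> \<I>" "projective_class C \<Q> \<J>" and X: "X \<in> Obj C"
  obtains F Z e m h Q P a b where "Q \<in> \<Q>" "P \<in> \<P>" "a \<in> Hom C Q F" "b \<in> Hom C F P"
    "cofibre_sequence C a b" "m \<in> ideal_product C \<I> \<J>" "e \<in> Hom C F X" "m \<in> Hom C X Z"
    "is_triangle C F X Z e m h" "(e, m, h) \<in> Tri C"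
proof -
  obtain Q Y q g y where g: "Q \<in> \<Q>" "g \<in> \<J>" "g \<in> Hom C X Y" "is_triangle C Q X Y q g y"
    "(q, g, y) \<in> Tri C"
    using projective_class_resolution[OF pc(2) X] by metis
  have Y: "Y \<in> Obj C" using g(3) Hom_Obj by blast
  obtain P Z p f z where f: "P \<in> \<P>" "f \<in> \<I>" "f \<in> Hom C Y Z" "is_triangle C P Y Z p f z"
    "(p, f, z) \<in> Tri C"
    using projective_class_resolution[OF pc(1) Y] by metis
  have fg: "f \<cdot> g \<in> Hom C X Z" using Comp_Hom f(3) g(3) by meson
  obtain F e h where e: "e \<in> Hom C F X" "is_triangle C F X Z e (f \<cdot> g) h" "(e, f \<cdot> g, h) \<in> Tri C"
    using fibre_exists[OF fg] by metis
  obtain a b where "a \<in> Hom C Q F" "b \<in> Hom C F P" "cofibre_sequence C a b"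
    using fibre_of_composite[OF g(4,5) f(4,5) e(2,3)] by metis
  then show thesis
    by (rule that[OF g(1) f(1) _ _ _ ideal_productI[OF f(2) g(2,3) f(3)] e(1) fg e(2,3)])
qed

lemma retracts_of_extensionsI:
  assumes "s \<in> Hom C Y X" "r \<in> Hom C X Y" "r \<cdot> s = Ident C Y"
    and "Q \<in> \<Q>" "P \<in> \<P>" "a \<in> Hom C Q X" "b \<in> Hom C X P" "cofibre_sequence C a b"
  shows "Y \<in> retracts_of_extensions C \<Q> \<P>"
  using assms Hom_Obj[OF assms(1)] unfolding retracts_of_extensions_def retract_of_def by blast

lemma extension_retracts_of_extensions:
  assumes "Q \<in> \<Q>" "P \<in> \<P>" "a \<in> Hom C Q X" "b \<in> Hom C X P" "cofibre_sequence C a b"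
  shows "X \<in> retracts_of_extensions C \<Q> \<P>"
proof -
  have "X \<in> Obj C" using assms(3) Hom_Obj by blast
  then show ?thesis
    using retracts_of_extensionsI[OF _ _ _ assms] Ident_Hom Comp_Ident_right by metis
qed

text \<open>An arrow out of \<open>X\<close> that kills every extension kills the fibre of a resolving arrow of \<open>X\<close>;
  it therefore factors through that arrow, and the other factor can be absorbed into \<open>\<I>\<close>.\<close>

lemma null_retracts_of_extensions:
  assumes pc: "projective_class C \<P> \<I>" "projective_class C \<Q> \<J>"
  shows "null C (retracts_of_extensions C \<Q> \<P>) = ideal_product C \<I> \<J>"
proof
  show "ideal_product C \<I> \<J> \<subseteq> null C (retracts_of_extensions C \<Q> \<P>)"
  proof
    fix m assume m: "m \<in> ideal_product C \<I> \<J>"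
    obtain X Z where "m \<in> Hom C X Z" using ideal_productE[OF pc m] by metis
    then have "m \<in> Arr C" by (simp add: Hom_def)
    then show "m \<in> null C (retracts_of_extensions C \<Q> \<P>)"
      using ideal_product_kills_extensions[OF pc _ m] Arr_Hom by (auto simp: null_def)
  qed
next
  show "null C (retracts_of_extensions C \<Q> \<P>) \<subseteq> ideal_product C \<I> \<J>"
  proof
    fix k assume k: "k \<in> null C (retracts_of_extensions C \<Q> \<P>)"
    define X D where "X = Dom C k" and "D = Cod C k"
    have kH: "k \<in> Hom C X D" using k by (simp add: null_def Hom_def X_def D_def)
    obtain F Z e m h Q P a b where r: "Q \<in> \<Q>" "P \<in> \<P>" "a \<in> Hom C Q F" "b \<in> Hom C F P"
      "cofibre_sequence C a b" "m \<in> ideal_product C \<I> \<J>" "e \<in> Hom C F X" "m \<in> Hom C X Z"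
      "is_triangle C F X Z e m h" "(e, m, h) \<in> Tri C"
      using product_resolution[OF pc] Hom_Obj[OF kH] by metis
    have "F \<in> retracts_of_extensions C \<Q> \<P>" by (rule extension_retracts_of_extensions[OF r(1-5)])
    then have "k \<cdot> e = Zero C F D" using k r(7) by (auto simp: null_def X_def D_def)
    then obtain t where t: "t \<in> Hom C Z D" "t \<cdot> m = k"
      using Tri_weak_cokernel[OF r(10,9) kH] by metis
    obtain f g Y where fg: "m = f \<cdot> g" "f \<in> \<I>" "g \<in> \<J>" "g \<in> Hom C X Y" "f \<in> Hom C Y Z"
      using ideal_productE[OF pc r(6)] Hom_DomCod r(8) by metis
    have "k = (t \<cdot> f) \<cdot> g" using t(2) fg(1) Comp_assoc[OF fg(4,5) t(1)] by simp
    moreover have "t \<cdot> f \<in> \<I>" by (rule projective_class_left_ideal[OF pc(1) fg(2,5) t(1)])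
    ultimately show "k \<in> ideal_product C \<I> \<J>"
      using ideal_productI fg(3,4) Comp_Hom[OF fg(5) t(1)] by metis
  qed
qed

lemma proj_ideal_product:
  assumes pc: "projective_class C \<P> \<I>" "projective_class C \<Q> \<J>"
  shows "proj C (ideal_product C \<I> \<J>) = retracts_of_extensions C \<Q> \<P>"
proof
  show "retracts_of_extensions C \<Q> \<P> \<subseteq> proj C (ideal_product C \<I> \<J>)"
  proof
    fix W assume W: "W \<in> retracts_of_extensions C \<Q> \<P>"
    have "m \<cdot> x = Zero C W (Cod C m)"
      if m: "m \<in> ideal_product C \<I> \<J>" and x: "x \<in> Hom C W (Dom C m)" for m x
    proof -
      have "m \<in> Hom C (Dom C m) (Cod C m)" using ideal_productE[OF pc m] Hom_DomCod by metis
      then show ?thesis using ideal_product_kills_extensions[OF pc W m _ x] by blast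
    qed
    moreover have "W \<in> Obj C" using W by (simp add: retracts_of_extensions_def)
    ultimately show "W \<in> proj C (ideal_product C \<I> \<J>)" by (simp add: proj_def)
  qed
next
  show "proj C (ideal_product C \<I> \<J>) \<subseteq> retracts_of_extensions C \<Q> \<P>"
  proof
    fix X assume X: "X \<in> proj C (ideal_product C \<I> \<J>)"
    then have XO: "X \<in> Obj C" by (simp add: proj_def)
    obtain F Z e m h Q P a b where r: "Q \<in> \<Q>" "P \<in> \<P>" "a \<in> Hom C Q F" "b \<in> Hom C F P"
      "cofibre_sequence C a b" "m \<in> ideal_product C \<I> \<J>" "e \<in> Hom C F X" "m \<in> Hom C X Z"
      "is_triangle C F X Z e m h" "(e, m, h) \<in> Tri C"
      using product_resolution[OF pc XO] by metis
    have "m \<cdot> Ident C X = Zero C X Z"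
      using X r(6) Ident_Hom[OF XO] Hom_DomCod[OF r(8)] by (simp add: proj_def)
    \<comment> \<open>An arrow in the ideal out of \<open>X\<close> is zero, so its fibre splits off \<open>X\<close>.\<close>
    then obtain s where s: "s \<in> Hom C X F" "e \<cdot> s = Ident C X"
      using Tri_weak_kernel[OF r(10,9) Ident_Hom[OF XO]] by metis
    show "X \<in> retracts_of_extensions C \<Q> \<P>"
      by (rule retracts_of_extensionsI[OF s(1) r(7) s(2) r(1-5)])
  qed
qed

theorem projective_class_product:
  assumes pc: "projective_class C \<P> \<I>" "projective_class C \<Q> \<J>"
  shows "projective_class C (retracts_of_extensions C \<Q> \<P>) (ideal_product C \<I> \<J>)"
proof -
  have "\<exists>P \<in> retracts_of_extensions C \<Q> \<P>. \<exists>Y. \<exists>p \<in> Hom C P X. \<exists>f \<in> Hom C X Y.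
        f \<in> ideal_product C \<I> \<J> \<and> cofibre_sequence C p f" if X: "X \<in> Obj C" for X
  proof -
    obtain F Z e m h Q P a b where r: "Q \<in> \<Q>" "P \<in> \<P>" "a \<in> Hom C Q F" "b \<in> Hom C F P"
      "cofibre_sequence C a b" "m \<in> ideal_product C \<I> \<J>" "e \<in> Hom C F X" "m \<in> Hom C X Z"
      "is_triangle C F X Z e m h" "(e, m, h) \<in> Tri C"
      using product_resolution[OF pc X] by metis
    have "cofibre_sequence C e m" using r(10) by (auto simp: cofibre_sequence_def)
    with r(6-8) extension_retracts_of_extensions[OF r(1-5)] show ?thesis by blast
  qed
  moreover have "retracts_of_extensions C \<Q> \<P> \<subseteq> Obj C"
    by (auto simp: retracts_of_extensions_def)
  moreover have "ideal_product C \<I> \<J> \<subseteq> Arr C"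
    using null_retracts_of_extensions[OF pc] by (auto simp: null_def)
  ultimately show ?thesis
    using null_retracts_of_extensions[OF pc] proj_ideal_product[OF pc]
    by (simp add: projective_class_def)
qed

section \<open>Stability\<close>

text \<open>Stability of the projectives is inherited from stability of the ideal: an arrow \<open>\<Sigma>P \<rightarrow> X\<close>
  corresponds to one \<open>P \<rightarrow> \<Sigma>\<^sup>-\<^sup>1X\<close>, and an arrow \<open>\<Sigma>\<^sup>-\<^sup>1P \<rightarrow> X\<close> to one \<open>P \<rightarrow> \<Sigma>X\<close>. So
  for a product of ideals only the ideal has to be inspected.\<close>

lemma stable_projective_classI:
  assumes pc: "projective_class C \<P> \<I>"
    and S: "\<And>f. f \<in> \<I> \<Longrightarrow> SuspA C f \<in> \<I>" and D: "\<And>f. f \<in> \<I> \<Longrightarrow> DesA C f \<in> \<I>"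
  shows "stable_projective_class C \<P> \<I>"
proof -
  obtain \<eta> where eta: "\<And>X. X \<in> Obj C \<Longrightarrow> \<eta> X \<in> Hom C X (DesO C (SuspO C X))"
    "\<And>X. X \<in> Obj C \<Longrightarrow> is_iso C (\<eta> X)"
    "\<And>X Y f. f \<in> Hom C X Y \<Longrightarrow> DesA C (SuspA C f) \<cdot> \<eta> X = \<eta> Y \<cdot> f"
    using unit by blast
  obtain \<epsilon> where eps: "\<And>X. X \<in> Obj C \<Longrightarrow> \<epsilon> X \<in> Hom C (SuspO C (DesO C X)) X"
    "\<And>X. X \<in> Obj C \<Longrightarrow> is_iso C (\<epsilon> X)"
    "\<And>X Y f. f \<in> Hom C X Y \<Longrightarrow> f \<cdot> \<epsilon> X = \<epsilon> Y \<cdot> SuspA C (DesA C f)"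
    using counit by blast
  have proj: "W \<in> \<P>" if W: "W \<in> Obj C"
    and "\<And>f g X Y. f \<in> \<I> \<Longrightarrow> f \<in> Hom C X Y \<Longrightarrow> g \<in> Hom C W X \<Longrightarrow> f \<cdot> g = Zero C W Y" for W
  proof -
    have "f \<in> Hom C (Dom C f) (Cod C f)" if "f \<in> \<I>" for f
      using pc that by (auto simp: projective_class_def Hom_def)
    then have "W \<in> proj C \<I>" using that unfolding proj_def by blast
    then show ?thesis using pc by (simp add: projective_class_def)
  qed
  have "SuspO C P \<in> \<P> \<and> DesO C P \<in> \<P>" if P: "P \<in> \<P>" for P
  proof
    have PO: "P \<in> Obj C" using pc P by (auto simp: projective_class_def)
    show "SuspO C P \<in> \<P>"
    proof (rule proj)
      show SP: "SuspO C P \<in> Obj C" using SuspO_Obj PO .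
      fix f g X Y assume f: "f \<in> \<I>" "f \<in> Hom C X Y" and g: "g \<in> Hom C (SuspO C P) X"
      have Y: "Y \<in> Obj C" "DesO C Y \<in> Obj C" using f(2) Hom_Obj DesO_Obj by auto
      have fg: "f \<cdot> g \<in> Hom C (SuspO C P) Y" using Comp_Hom f g by meson
      note Df = DesA_Hom[OF f(2)] and Dg = DesA_Hom[OF g] and Dfg = DesA_Hom[OF fg]
      have "DesA C (f \<cdot> g) \<cdot> \<eta> P = DesA C f \<cdot> (DesA C g \<cdot> \<eta> P)"
        using DesA_Comp[OF g f(2)] Comp_assoc[OF eta(1)[OF PO] Dg Df] by simp
      also have "\<dots> = Zero C P (DesO C Y)"
        using projective_class_zero[OF pc P D[OF f(1)] Df] Comp_Hom[OF eta(1)[OF PO] Dg] by blast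
      finally have "DesA C (f \<cdot> g) \<cdot> \<eta> P = Zero C (DesO C (SuspO C P)) (DesO C Y) \<cdot> \<eta> P"
        using Zero_Comp[OF eta(1)[OF PO] Y(2)] by simp
      then have "DesA C (f \<cdot> g) = Zero C (DesO C (SuspO C P)) (DesO C Y)"
        using iso_right_cancel[OF eta(2)[OF PO] eta(1)[OF PO] Dfg] Zero_Hom DesO_Obj[OF SP] Y(2)
        by metis
      then have "(f \<cdot> g) \<cdot> \<epsilon> (SuspO C P) = Zero C (SuspO C (DesO C (SuspO C P))) Y"
        using eps(3)[OF fg] SuspA_Zero[OF DesO_Obj[OF SP] Y(2)] Comp_Zero[OF eps(1)[OF Y(1)]]
          SuspO_Obj[OF DesO_Obj[OF SP]] by simp
      also have "\<dots> = Zero C (SuspO C P) Y \<cdot> \<epsilon> (SuspO C P)"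
        using Zero_Comp[OF eps(1)[OF SP] Y(1)] by simp
      finally show "f \<cdot> g = Zero C (SuspO C P) Y"
        using iso_right_cancel[OF eps(2)[OF SP] eps(1)[OF SP] fg] Zero_Hom[OF SP Y(1)] by blast
    qed
    show "DesO C P \<in> \<P>"
    proof (rule proj)
      show DP: "DesO C P \<in> Obj C" using DesO_Obj PO .
      fix f g X Y assume f: "f \<in> \<I>" "f \<in> Hom C X Y" and g: "g \<in> Hom C (DesO C P) X"
      have Y: "Y \<in> Obj C" "SuspO C Y \<in> Obj C" using f(2) Hom_Obj SuspO_Obj by auto
      have fg: "f \<cdot> g \<in> Hom C (DesO C P) Y" using Comp_Hom f g by meson
      note Sf = SuspA_Hom[OF f(2)] and Sg = SuspA_Hom[OF g]
      obtain i where i: "i \<in> Hom C P (SuspO C (DesO C P))" "i \<cdot> \<epsilon> P = Ident C (SuspO C (DesO C P))"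
        using is_iso_inverse eps(1,2) PO by metis
      have Sgi: "SuspA C g \<cdot> i \<in> Hom C P (SuspO C X)" using Comp_Hom i(1) Sg by meson
      have "SuspA C (f \<cdot> g) = SuspA C f \<cdot> ((SuspA C g \<cdot> i) \<cdot> \<epsilon> P)"
        using SuspA_Comp[OF g f(2)] Comp_cancel[OF eps(1)[OF PO] i(2,1) Sg] by simp
      also have "\<dots> = (SuspA C f \<cdot> (SuspA C g \<cdot> i)) \<cdot> \<epsilon> P"
        using Comp_assoc[OF eps(1)[OF PO] Sgi Sf] by simp
      also have "\<dots> = Zero C P (SuspO C Y) \<cdot> \<epsilon> P"
        using projective_class_zero[OF pc P S[OF f(1)] Sf Sgi] by simp
      also have "\<dots> = SuspA C (Zero C (DesO C P) Y)"
        using Zero_Comp[OF eps(1)[OF PO] Y(2)] SuspA_Zero[OF DP Y(1)] by simp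
      finally show "f \<cdot> g = Zero C (DesO C P) Y"
        using SuspA_faithful fg Zero_Hom[OF DP Y(1)] by meson
    qed
  qed
  then show ?thesis using pc S D by (simp add: stable_projective_class_def)
qed

theorem stable_projective_class_product:
  assumes st: "stable_projective_class C \<P> \<I>" "stable_projective_class C \<Q> \<J>"
  shows "stable_projective_class C (retracts_of_extensions C \<Q> \<P>) (ideal_product C \<I> \<J>)"
proof (rule stable_projective_classI)
  have pc: "projective_class C \<P> \<I>" "projective_class C \<Q> \<J>"
    using st by (auto simp: stable_projective_class_def)
  then show "projective_class C (retracts_of_extensions C \<Q> \<P>) (ideal_product C \<I> \<J>)"
    by (rule projective_class_product)
  fix m assume "m \<in> ideal_product C \<I> \<J>"
  then obtain f g X Y Z where m: "m = f \<cdot> g" "f \<in> \<I>" "g \<in> \<J>" "g \<in> Hom C X Y" "f \<in> Hom C Y Z"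
    using ideal_productE[OF pc] by metis
  have I: "SuspA C f \<in> \<I>" "SuspA C g \<in> \<J>" "DesA C f \<in> \<I>" "DesA C g \<in> \<J>"
    using st m(2,3) by (auto simp: stable_projective_class_def)
  show "SuspA C m \<in> ideal_product C \<I> \<J>"
    using ideal_productI[OF I(1,2) SuspA_Hom[OF m(4)] SuspA_Hom[OF m(5)]] SuspA_Comp[OF m(4,5)] m(1)
    by simp
  show "DesA C m \<in> ideal_product C \<I> \<J>"
    using ideal_productI[OF I(3,4) DesA_Hom[OF m(4)] DesA_Hom[OF m(5)]] DesA_Comp[OF m(4,5)] m(1)
    by simp
qed

end

theorem proposition3p3:
  fixes \<S> :: "('o, 'a) tricat" and small :: "'i set \<Rightarrow> bool"
    and \<P> \<Q> :: "'o set" and \<I> \<J> :: "'a set"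
  assumes "triangulated_category \<S>"
    and "small_sets small" and "has_small_coproducts small \<S>"
    and "projective_class \<S> \<P> \<I>" and "projective_class \<S> \<Q> \<J>"
  shows "projective_class \<S> (retracts_of_extensions \<S> \<Q> \<P>) (ideal_product \<S> \<I> \<J>) \<and>
    (stable_projective_class \<S> \<P> \<I> \<and> stable_projective_class \<S> \<Q> \<J> \<longrightarrow>
      stable_projective_class \<S> (retracts_of_extensions \<S> \<Q> \<P>) (ideal_product \<S> \<I> \<J>))"
  using triangulated_category.projective_class_product[OF assms(1,4,5)]
    triangulated_category.stable_projective_class_product[OF assms(1)] by blast

end
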